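(* Let $R$ be a commutative ring with unity and $m\ge1$ an integer. Let $\lambda_1,\mu_1:\mathbb N\times\mathbb Z\to R$ have triangular support of order $m$, with $\lambda_1(r,0),\mu_1(r,0)\in R^\times$ for $0\le r\le m-1$, and put $$f_n(x)=\sum_{b=0}^{w_m(n)}\lambda_1(n,b)\,x^{n-mb},\qquad g_n(x)=\sum_{c=0}^{w_m(n)}\mu_1(n,c)\,x^{n-mc}\qquad(n\in\mathbb N).$$ Assume that $\lambda_1$ and $\mu_1$ are lambda-recursive of order $m$ with parameters independent of $k$: there are $p^{(1)}_n,p^{(2)}_n\in R^\times$ and $h^{(1)}_n,h^{(2)}_n\in R$ ($n\ge m$) such that, for all $n\ge m$ and $0\le k\le w_m(n)$, $$\lambda_1(n,k)=p^{(1)}_n\lambda_1(n-1,k)-h^{(1)}_n\lambda_1(n-m,k-1),\qquad \mu_1(n,k)=p^{(2)}_n\mu_1(n-1,k)-h^{(2)}_n\mu_1(n-m,k-1),$$ while $\lambda_1(n,0)=c^{(1)}_n$ and $\mu_1(n,0)=c^{(2)}_n$ for $0\le n\le m-1$, where $c^{(i)}_n\in R$ are given initial data. For $(n,k)$ write $t=n-km$, $s=n-(k-1)m$, and define $$A_\mu(n,k)=\begin{cases}\dfrac1{p^{(2)}_t},&t\ge m,\\[6pt] \dfrac{\mu_1(t-1,0)}{\mu_1(t,0)},&1\le t<m,\\[6pt] 0,&t=0,\end{cases}\qquad A_\lambda(n,k)=\begin{cases}\dfrac1{p^{(1)}_t},&t\ge m,\\[6pt] \dfrac{\lambda_1(t-1,0)}{\lambda_1(t,0)},&1\le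 t<m,\\[6pt] 0,&t=0.\end{cases}$$ Direction $f\Rightarrow g$. Assume that there exists a family $\mu_3:\mathbb N\times\mathbb Z\to R$ with triangular support of order $m$ such that, for all $n\in\mathbb N$, $$x^n=\sum_{k=0}^{w_m(n)}\mu_3(n,k)\,g_{n-mk}(x),\qquad \mu_3(n,0)=\frac1{\mu_1(n,0)},$$ and, for $1\le k\le w_m(n)$, $$\mu_3(n,k)=A_\mu(n,k)\,\mu_3(n-1,k)+\frac{h^{(2)}_s}{p^{(2)}_s}\,\mu_3(n-1,k-1).$$ Define $z(n,k)=\sum_{b=0}^{k}\lambda_1(n,b)\,\mu_3(n-mb,k-b)$ for $0\le k\le w_m(n)$ and $z(n,k)=0$ for $k<0$ or $k>w_m(n)$. Then, for all $n\in\mathbb N$, $$f_n(x)=\sum_{k=0}^{w_m(n)}g_{n-mk}(x)\,z(n,k),\qquad z(n,0)=\frac{\lambda_1(n,0)}{\mu_1(n,0)},$$ and, for $1\le k\le w_m(n)$, $$z(n,k)=p^{(1)}_nA_\mu(n,k)\,z(n-1,k)+p^{(1)}_n\frac{h^{(2)}_s}{p^{(2)}_s}\,z(n-1,k-1)-h^{(1)}_n\,z(n-m,k-1).$$ Direction $g\Rightarrow f$. Symmetrically, assume that there exists a family $\lambda_3:\mathbb N\times\mathbb Z\to R$ with triangular support of order $m$ such that, for all $n\in\mathbb N$, $$x^n=\sum_{k=0}^{w_m(n)}\lambda_3(n,k)\,f_{n-mk}(x),\qquad \lambda_3(n,0)=\frac1{\lambda_1(n,0)},$$ and, for $1\le k\le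 w_m(n)$, $$\lambda_3(n,k)=A_\lambda(n,k)\,\lambda_3(n-1,k)+\frac{h^{(1)}_s}{p^{(1)}_s}\,\lambda_3(n-1,k-1).$$ Define $y(n,k)=\sum_{b=0}^{k}\mu_1(n,b)\,\lambda_3(n-mb,k-b)$ for $0\le k\le w_m(n)$ and $y(n,k)=0$ for $k<0$ or $k>w_m(n)$. Then, for all $n\in\mathbb N$, $$g_n(x)=\sum_{k=0}^{w_m(n)}f_{n-mk}(x)\,y(n,k),\qquad y(n,0)=\frac{\mu_1(n,0)}{\lambda_1(n,0)},$$ and, for $1\le k\le w_m(n)$, $$y(n,k)=p^{(2)}_nA_\lambda(n,k)\,y(n-1,k)+p^{(2)}_n\frac{h^{(1)}_s}{p^{(1)}_s}\,y(n-1,k-1)-h^{(2)}_n\,y(n-m,k-1).$$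
   Context: $\mathbb N=\{0,1,2,\dots\}$, $w_m(n)=\lfloor n/m\rfloor$, and $R^\times$ is the group of units of $R$. A family $\lambda:\mathbb N\times\mathbb Z\to R$ has triangular support of order $m$ (written $\lambda\in\Delta_m$) if $\lambda(n,k)=0$ whenever $k<0$ or $k>w_m(n)$. Under the stated assumptions, $\lambda_1(n,0)$ and $\mu_1(n,0)$ are units for all $n\ge0$, so all fractions are defined. *)

theory Defs
  imports "HOL-Computational_Algebra.Polynomial"
begin

text \<open>The coefficient ring has sort \<open>{comm_ring, comm_monoid_mult}\<close>: a commutative ring with unity.
  The class \<open>comm_ring_1\<close> would in addition demand \<open>0 \<noteq> 1\<close> and so exclude the zero ring.
  Units are the divisors of 1. Fractions are total: \<open>a \<oslash> b\<close> is meaningful only for a unit \<open>b\<close>.\<close>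

definition unit_quot :: "'a::{comm_ring, comm_monoid_mult} \<Rightarrow> 'a \<Rightarrow> 'a"  (infixl "\<oslash>" 70)
  where "a \<oslash> b = a * (THE c. b * c = 1)"

lemma unit_quot_mult:
  fixes a b :: "'a::{comm_ring, comm_monoid_mult}"
  assumes "b dvd 1"
  shows "(a \<oslash> b) * b = a"
proof -
  obtain c where c: "b * c = 1" using assms by (metis dvdE)
  have "(THE d. b * d = 1) = c"
  proof (rule the_equality[of "\<lambda>d. b * d = 1", OF c])
    fix d assume "b * d = 1"
    then show "d = c" using c by (metis mult.assoc mult.commute mult_1)
  qed
  then show ?thesis using c unfolding unit_quot_def
    by (metis mult.assoc mult.commute mult_1)
qed

definition w :: "nat \<Rightarrow> nat \<Rightarrow> nat"
  where "w m n = n div m"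

definition Delta :: "nat \<Rightarrow> (nat \<Rightarrow> int \<Rightarrow> 'a::{comm_ring, comm_monoid_mult}) set"
  where "Delta m = {l. \<forall>n k. k < 0 \<or> k > int (w m n) \<longrightarrow> l n k = 0}"

text \<open>Lambda-recursiveness of order \<open>m\<close> with parameters \<open>p\<close>, \<open>h\<close> independent of \<open>k\<close> and
  initial data \<open>c\<close>. The values of \<open>p\<close> and \<open>h\<close> below \<open>m\<close>, and of \<open>c\<close> from \<open>m\<close> on,
  are irrelevant.\<close>

definition lambda_recursive ::
    "nat \<Rightarrow> (nat \<Rightarrow> 'a) \<Rightarrow> (nat \<Rightarrow> 'a) \<Rightarrow> (nat \<Rightarrow> 'a) \<Rightarrow>
     (nat \<Rightarrow> int \<Rightarrow> 'a::{comm_ring, comm_monoid_mult}) \<Rightarrow> bool"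
  where "lambda_recursive m p h c l \<longleftrightarrow>
    (\<forall>n\<ge>m. p n dvd 1) \<and>
    (\<forall>n\<ge>m. \<forall>k. 0 \<le> k \<and> k \<le> int (w m n) \<longrightarrow>
        l n k = p n * l (n - 1) k - h n * l (n - m) (k - 1)) \<and>
    (\<forall>n<m. l n 0 = c n)"

definition lambda_poly ::
    "nat \<Rightarrow> (nat \<Rightarrow> int \<Rightarrow> 'a::{comm_ring, comm_monoid_mult}) \<Rightarrow> nat \<Rightarrow> 'a poly"
  where "lambda_poly m l n = (\<Sum>b = 0..w m n. monom (l n (int b)) (n - m * b))"

text \<open>The coefficients \<open>A\<^sub>\<lambda>\<close> and \<open>A\<^sub>\<mu>\<close>, with \<open>t = n - k m\<close>. They are used only for
  \<open>k \<le> w m n\<close>, where \<open>t \<ge> 0\<close> and \<open>nat\<close> does not truncate.\<close>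

definition A_coeff ::
    "nat \<Rightarrow> (nat \<Rightarrow> 'a) \<Rightarrow> (nat \<Rightarrow> int \<Rightarrow> 'a::{comm_ring, comm_monoid_mult}) \<Rightarrow> nat \<Rightarrow> int \<Rightarrow> 'a"
  where "A_coeff m p l n k =
    (let t = nat (int n - k * int m) in
      if t \<ge> m then 1 \<oslash> p t
      else if t \<ge> 1 then l (t - 1) 0 \<oslash> l t 0
      else 0)"

definition s_index :: "nat \<Rightarrow> nat \<Rightarrow> int \<Rightarrow> nat"
  where "s_index m n k = nat (int n - (k - 1) * int m)"

definition connection_coeff ::
    "nat \<Rightarrow> (nat \<Rightarrow> int \<Rightarrow> 'a) \<Rightarrow> (nat \<Rightarrow> int \<Rightarrow> 'a::{comm_ring, comm_monoid_mult}) \<Rightarrow>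
     nat \<Rightarrow> int \<Rightarrow> 'a"
  where "connection_coeff m l u n k =
    (if 0 \<le> k \<and> k \<le> int (w m n)
     then (\<Sum>b = 0..k. l n b * u (n - m * nat b) (k - b))
     else 0)"

end

(* Substituting the expansion of x^n into f_n gives z. In z(n,k), apply the recursion of lambda_1
   to the first factor and that of mu_3 to the second. The index pair (n - mb, k - b) has the
   same t and s for every b, so the coefficients A and h/p leave the sum. The term b = k, where
   the recursion of mu_3 is not available, satisfies A(n,k) mu_3(t-1,0) = mu_3(t,0) because
   A(n,k) = mu_1(t-1,0) / mu_1(t,0). When t = 0 it vanishes together with lambda_1(n-1,k). *)

theory Submission
  imports Defs
begin

text \<open>The definition sums over integers. With natural indices the sum can be split at its last
  summand, shifted by \<open>Suc\<close>, and obtained from a triangular double sum.\<close>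

lemma connection_coeff_nat:
  assumes "k \<le> w m n"
  shows "connection_coeff m l u n (int k) = (\<Sum>b\<le>k. l n (int b) * u (n - m * b) (int (k - b)))"
proof -
  have "(\<Sum>b = 0..int k. l n b * u (n - m * nat b) (int k - b))
      = (\<Sum>b\<le>k. l n (int b) * u (n - m * b) (int (k - b)))"
    by (rule sum.reindex_bij_witness[where i = int and j = nat]) (auto simp: of_nat_diff)
  with assms show ?thesis
    by (simp add: connection_coeff_def)
qed

text \<open>Removing \<open>b\<close> blocks of length \<open>m\<close> lowers the quotient by
  \<open>b\<close>. If \<open>m * b\<close> exceeds \<open>n\<close>, both subtractions truncate to
  0, so no bound on \<open>b\<close> appears.\<close>

lemma w_diff_mult:
  assumes "m \<ge> 1"
  shows "w m (n - m * b) = w m n - b"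
proof (cases "m * b \<le> n")
  case True
  then have "w m n = (n - m * b + m * b) div m"
    by (simp add: w_def)
  also have "\<dots> = (n - m * b) div m + b"
    using assms by (simp del: le_add_diff_inverse2)
  finally show ?thesis
    by (simp add: w_def)
next
  case False
  then have "w m n \<le> b"
    by (simp add: w_def less_imp_le less_mult_imp_div_less mult.commute)
  with False show ?thesis
    by (simp add: w_def)
qed

lemma smult_sum_right: "smult a (\<Sum>i\<in>S. f i) = (\<Sum>i\<in>S. smult a (f i))"
  by (induction S rule: infinite_finite_induct) (simp_all add: smult_add_right)

text \<open>Each power \<open>n - m * b\<close> is expanded by \<open>inv\<close>, and the summands
  with \<open>b + j = k\<close> are collected: they all carry the same polynomial
  \<open>g (n - m * k)\<close>.\<close>

lemma lambda_poly_connection: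
  assumes m: "m \<ge> 1"
    and inv: "\<And>n. monom 1 n = (\<Sum>k = 0..w m n. smult (u n (int k)) (g (n - m * k)))"
  shows "lambda_poly m l n
    = (\<Sum>k = 0..w m n. smult (connection_coeff m l u n (int k)) (g (n - m * k)))"
proof -
  let ?W = "w m n"
  let ?F = "\<lambda>b j. smult (l n (int b) * u (n - m * b) (int j)) (g (n - m * (b + j)))"
  have "monom (l n (int b)) (n - m * b) = (\<Sum>j\<le>?W - b. ?F b j)" for b
  proof -
    have "monom (l n (int b)) (n - m * b) = smult (l n (int b)) (monom 1 (n - m * b))"
      by (simp add: smult_monom)
    also have "\<dots> = (\<Sum>j\<le>?W - b. ?F b j)"
      unfolding inv[of "n - m * b"] w_diff_mult[OF m] smult_sum_right
      by (simp add: atLeast0AtMost diff_diff_left distrib_left)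
    finally show ?thesis .
  qed
  then have "lambda_poly m l n = (\<Sum>b\<le>?W. \<Sum>j\<le>?W - b. ?F b j)"
    by (simp add: lambda_poly_def atLeast0AtMost)
  \<comment> \<open>The nested bounds describe the triangle \<open>b + j \<le> ?W\<close>, which is
    then summed along its diagonals.\<close>
  also have "\<dots> = (\<Sum>(b, j)\<in>{(b, j). b + j \<le> ?W}. ?F b j)"
    by (subst sum.Sigma) (auto intro!: sum.cong)
  also have "\<dots> = (\<Sum>k\<le>?W. \<Sum>b\<le>k. ?F b (k - b))"
    by (rule sum.triangle_reindex_eq)
  also have "\<dots> = (\<Sum>k\<le>?W. smult (connection_coeff m l u n (int k)) (g (n - m * k)))"
    by (simp add: connection_coeff_nat smult_sum)
  finally show ?thesis
    by (simp add: atLeast0AtMost)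
qed

text \<open>At \<open>k = 0\<close> the term with \<open>h\<close> has second index -1, outside the
  triangular support.\<close>

lemma lambda_recursive_col0:
  assumes "l \<in> Delta m" and "lambda_recursive m p h c l" and "n \<ge> m"
  shows "l n 0 = p n * l (n - 1) 0"
proof -
  have "l (n - m) (0 - 1) = 0"
    using assms(1) by (simp add: Delta_def)
  moreover have "l n 0 = p n * l (n - 1) 0 - h n * l (n - m) (0 - 1)"
    using assms(2,3) unfolding lambda_recursive_def by (metis of_nat_0_le_iff order_refl)
  ultimately show ?thesis
    by simp
qed

text \<open>Units below \<open>m\<close> by assumption; from \<open>m\<close> on, each value is the
  unit \<open>p n\<close> times the previous one.\<close>

lemma lambda_recursive_col0_unit:
  assumes m: "m \<ge> 1" and D: "l \<in> Delta m" and init: "\<forall>r<m. l r 0 dvd 1"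
    and rec: "lambda_recursive m p h c l"
  shows "l n 0 dvd 1"
proof (induction n rule: less_induct)
  case (less n)
  show ?case
  proof (cases "n < m")
    case True
    then show ?thesis using init by blast
  next
    case False
    then have "p n dvd 1" "l (n - 1) 0 dvd 1"
      using rec m less by (auto simp: lambda_recursive_def)
    then have "p n * l (n - 1) 0 dvd 1 * 1"
      by (rule mult_dvd_mono)
    then show ?thesis
      using lambda_recursive_col0[OF D rec, of n] False by simp
  qed
qed

text \<open>For \<open>t \<ge> 1\<close> both branches of \<open>A_coeff\<close> are the ratio of
  the column-zero values at \<open>t - 1\<close> and \<open>t\<close>, since
  \<open>l t 0 = p t * l (t - 1) 0\<close> once \<open>t \<ge> m\<close>. The condition on
  \<open>k\<close> says \<open>t \<ge> 1\<close>.\<close>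

lemma A_coeff_mult:
  assumes D: "l \<in> Delta m" and init: "\<forall>r<m. l r 0 dvd 1"
    and rec: "lambda_recursive m p h c l"
    and k: "m * k < n"
  shows "A_coeff m p l n (int k) * l (n - m * k) 0 = l (n - m * k - 1) 0"
proof -
  define t where "t = n - m * k"
  have t: "nat (int n - int k * int m) = t"
    using k by (simp add: t_def nat_diff_distrib' nat_mult_distrib mult.commute flip: of_nat_mult)
  have "t \<ge> 1"
    using k by (simp add: t_def)
  show ?thesis
  proof (cases "t \<ge> m")
    case True
    then have "p t dvd 1"
      using rec by (simp add: lambda_recursive_def)
    then have "1 \<oslash> p t * p t = 1"
      by (rule unit_quot_mult)
    moreover have "l t 0 = p t * l (t - 1) 0"
      by (rule lambda_recursive_col0[OF D rec True])
    ultimately have "1 \<oslash> p t * l t 0 = l (t - 1) 0"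
      by (metis mult.assoc mult_1)
    with True show ?thesis
      by (simp add: A_coeff_def Let_def t flip: t_def)
  next
    case False
    with \<open>t \<ge> 1\<close> init show ?thesis
      by (simp add: A_coeff_def Let_def t unit_quot_mult flip: t_def)
  qed
qed

text \<open>Supplies the missing case of the recursion for the inverse family, at second index 0. It
  is \<open>A_coeff_mult\<close> multiplied by the inverses of both column-zero values.\<close>

lemma A_coeff_inverse:
  assumes m: "m \<ge> 1" and D: "l \<in> Delta m" and init: "\<forall>r<m. l r 0 dvd 1"
    and rec: "lambda_recursive m p h c l"
    and k: "m * k < n"
  shows "A_coeff m p l n (int k) * (1 \<oslash> l (n - m * k - 1) 0) = 1 \<oslash> l (n - m * k) 0"
proof -
  let ?A = "A_coeff m p l n (int k)" and ?x = "l (n - m * k) 0" and ?y = "l (n - m * k - 1) 0"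
  have x: "(1 \<oslash> ?x) * ?x = 1" and y: "(1 \<oslash> ?y) * ?y = 1"
    by (rule unit_quot_mult, rule lambda_recursive_col0_unit[OF m D init rec])+
  have "?A * (1 \<oslash> ?y) = ?A * (1 \<oslash> ?y) * ((1 \<oslash> ?x) * ?x)"
    unfolding x by simp
  also have "\<dots> = (?A * ?x) * (1 \<oslash> ?y) * (1 \<oslash> ?x)"
    by (simp only: ac_simps)
  also have "\<dots> = ((1 \<oslash> ?y) * ?y) * (1 \<oslash> ?x)"
    unfolding A_coeff_mult[OF D init rec k] by (simp only: ac_simps)
  finally show ?thesis
    unfolding y by simp
qed

text \<open>Here \<open>l1\<close> is the family being expanded, \<open>l2\<close> belongs to the
  target polynomials, and \<open>u\<close> stands for the inverse coefficients of \<open>l2\<close>,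
  so one statement serves both directions. The first two terms come from the recursion of
  \<open>u\<close>, the third from the \<open>h1\<close> part of \<open>l1\<close>.\<close>

lemma connection_coeff_rec:
  fixes l1 l2 :: "nat \<Rightarrow> int \<Rightarrow> 'a::{comm_ring, comm_monoid_mult}"
  assumes m: "m \<ge> 1" and D1: "l1 \<in> Delta m" and D2: "l2 \<in> Delta m"
    and init: "\<forall>r<m. l2 r 0 dvd 1"
    and rec1: "lambda_recursive m p1 h1 c1 l1" and rec2: "lambda_recursive m p2 h2 c2 l2"
    and u0: "\<And>n. u n 0 = 1 \<oslash> l2 n 0"
    and u_rec: "\<And>n k. 1 \<le> k \<Longrightarrow> k \<le> int (w m n) \<Longrightarrow>
           u n k = A_coeff m p2 l2 n k * u (n - 1) k
             + (h2 (s_index m n k) \<oslash> p2 (s_index m n k)) * u (n - 1) (k - 1)"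
    and k: "1 \<le> k" "k \<le> int (w m n)"
  shows "connection_coeff m l1 u n k
    = p1 n * A_coeff m p2 l2 n k * connection_coeff m l1 u (n - 1) k
      + p1 n * (h2 (s_index m n k) \<oslash> p2 (s_index m n k)) * connection_coeff m l1 u (n - 1) (k - 1)
      - h1 n * connection_coeff m l1 u (n - m) (k - 1)"
proof -
  obtain j where kj: "k = int (Suc j)"
    using k by (metis Suc_pred int_one_le_iff_zero_less nat_0_le zero_less_nat_eq
        order_trans zero_le_one)
  have j: "Suc j \<le> w m n"
    using k kj by simp
  then have mj: "m * Suc j \<le> n"
    using m by (simp add: w_def less_eq_div_iff_mult_less_eq mult.commute)
  then have nm: "n \<ge> m" and mj': "m * j \<le> n - m"
    by simp_all
  define A where "A = A_coeff m p2 l2 n k"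
  define H where "H = h2 (s_index m n k) \<oslash> p2 (s_index m n k)"
  have split: "l1 n (int b) = p1 n * l1 (n - 1) (int b) - h1 n * l1 (n - m) (int b - 1)"
    if "b \<le> Suc j" for b
    using rec1 nm that j by (simp add: lambda_recursive_def)
  \<comment> \<open>The bound \<open>b \<le> j\<close> keeps the second index at least 1, where
    \<open>u_rec\<close> applies. Both t and s are unchanged because
    \<open>(n - m * b) - (k - b) * m = n - k * m\<close>.\<close>
  have u_step: "u (n - m * b) (int (Suc j - b))
      = A * u (n - 1 - m * b) (int (Suc j - b)) + H * u (n - 1 - m * b) (int (j - b))"
    if b: "b \<le> j" for b
  proof -
    have "m * b \<le> n"
      using mj b by (meson le_SucI mult_le_mono2 order_trans)
    then have n_b: "int (n - m * b) = int n - int m * int b"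
      by (simp only: of_nat_diff of_nat_mult)
    have "int (n - m * b) - int (Suc j - b) * int m = int n - k * int m"
      using b unfolding n_b by (simp add: kj of_nat_diff algebra_simps)
    then have A_eq: "A_coeff m p2 l2 (n - m * b) (int (Suc j - b)) = A"
      by (simp add: A_coeff_def A_def)
    have s_eq: "s_index m (n - m * b) (int (Suc j - b)) = s_index m n k"
      using b unfolding s_index_def n_b by (simp add: kj of_nat_diff algebra_simps)
    have "u (n - m * b) (int (Suc j - b))
        = A * u (n - m * b - 1) (int (Suc j - b)) + H * u (n - m * b - 1) (int (Suc j - b) - 1)"
      unfolding A_eq[symmetric] H_def s_eq[symmetric]
      using b j by (intro u_rec) (simp_all add: w_diff_mult[OF m])
    then show ?thesis
      using b by (simp add: diff_commute Suc_diff_le)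
  qed
  \<comment> \<open>The factor \<open>l1 (n - 1) k\<close> is kept for the case
    \<open>n = m * Suc j\<close>: there \<open>A\<close> is 0 and the bare identity would read
    \<open>u 0 0 = 0\<close>, but this factor vanishes.\<close>
  have top: "l1 (n - 1) k * u (n - m * Suc j) 0 = A * (l1 (n - 1) k * u (n - 1 - m * Suc j) 0)"
  proof (cases "m * Suc j < n")
    case True
    have "u (n - m * Suc j) 0 = A * u (n - 1 - m * Suc j) 0"
      unfolding u0 A_def kj diff_commute[of n 1]
      by (rule A_coeff_inverse[OF m D2 init rec2 True, symmetric])
    then show ?thesis
      by (simp only: mult.left_commute)
  next
    case False
    with mj have "n - 1 < m * Suc j"
      using m by auto
    then have "w m (n - 1) < Suc j"
      by (simp add: w_def less_mult_imp_div_less mult.commute)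
    then have "l1 (n - 1) k = 0"
      using D1 by (simp add: Delta_def kj)
    then show ?thesis
      by simp
  qed
  \<comment> \<open>If \<open>k\<close> exceeds \<open>w m (n - 1)\<close>, then
    \<open>connection_coeff\<close> is 0 by its default value and need not match the sum. This
    forces \<open>n = m * k\<close>, so \<open>A = 0\<close> settles it.\<close>
  have z_A: "(\<Sum>b\<le>Suc j. l1 (n - 1) (int b) * (A * u (n - 1 - m * b) (int (Suc j - b))))
      = A * connection_coeff m l1 u (n - 1) k"
  proof (cases "Suc j \<le> w m (n - 1)")
    case True
    then show ?thesis
      unfolding kj connection_coeff_nat[OF True] sum_distrib_left
      by (simp add: mult.left_commute)
  next
    case False
    then have "n < m * Suc j + 1"
      using m by (simp add: w_def less_eq_div_iff_mult_less_eq mult.commute)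
    with mj have "n = m * Suc j"
      by simp
    then have "nat (int n - k * int m) = 0"
      by (simp only: kj of_nat_mult mult.commute[of "int m"] diff_self nat_0)
    then have "A = 0"
      using m by (simp add: A_def A_coeff_def)
    then show ?thesis
      by simp
  qed
  have "j \<le> w m (n - 1)"
  proof -
    have "j * m \<le> n - 1"
      using mj' m by (simp add: mult.commute)
    then show ?thesis
      using m by (simp add: w_def less_eq_div_iff_mult_less_eq)
  qed
  then have z_H: "(\<Sum>b\<le>j. l1 (n - 1) (int b) * (H * u (n - 1 - m * b) (int (j - b))))
      = H * connection_coeff m l1 u (n - 1) (k - 1)"
    by (simp add: kj connection_coeff_nat sum_distrib_left mult.left_commute)
  have "j \<le> w m (n - m)"
    using mj' m by (simp add: w_def less_eq_div_iff_mult_less_eq mult.commute)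
  \<comment> \<open>The summand \<open>b = 0\<close> has second index -1 and vanishes; shifting
    \<open>b\<close> by one turns the rest into the coefficient at \<open>n - m\<close>.\<close>
  then have z_m: "(\<Sum>b\<le>Suc j. l1 (n - m) (int b - 1) * u (n - m * b) (int (Suc j - b)))
      = connection_coeff m l1 u (n - m) (k - 1)"
    using D1 unfolding sum.atMost_Suc_shift
    by (simp add: kj connection_coeff_nat Delta_def diff_diff_left)
  have "connection_coeff m l1 u n k
      = (\<Sum>b\<le>Suc j. l1 n (int b) * u (n - m * b) (int (Suc j - b)))"
    unfolding kj by (rule connection_coeff_nat[OF j])
  also have "\<dots> = (\<Sum>b\<le>Suc j. p1 n * (l1 (n - 1) (int b) * u (n - m * b) (int (Suc j - b)))
      - h1 n * (l1 (n - m) (int b - 1) * u (n - m * b) (int (Suc j - b))))"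
    by (rule sum.cong) (simp_all add: split left_diff_distrib mult.assoc)
  also have "\<dots> = p1 n * (\<Sum>b\<le>Suc j. l1 (n - 1) (int b) * u (n - m * b) (int (Suc j - b)))
      - h1 n * connection_coeff m l1 u (n - m) (k - 1)"
    by (simp only: sum_subtractf sum_distrib_left z_m[symmetric])
  \<comment> \<open>The summand \<open>b = Suc j\<close> comes from \<open>top\<close> and has no
    \<open>H\<close> part, hence the upper limit \<open>j\<close> in the second sum.\<close>
  also have "(\<Sum>b\<le>Suc j. l1 (n - 1) (int b) * u (n - m * b) (int (Suc j - b)))
      = (\<Sum>b\<le>Suc j. l1 (n - 1) (int b) * (A * u (n - 1 - m * b) (int (Suc j - b))))
        + (\<Sum>b\<le>j. l1 (n - 1) (int b) * (H * u (n - 1 - m * b) (int (j - b))))"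
  proof -
    have "(\<Sum>b\<le>j. l1 (n - 1) (int b) * u (n - m * b) (int (Suc j - b)))
      = (\<Sum>b\<le>j. l1 (n - 1) (int b) * (A * u (n - 1 - m * b) (int (Suc j - b))))
        + (\<Sum>b\<le>j. l1 (n - 1) (int b) * (H * u (n - 1 - m * b) (int (j - b))))"
      unfolding sum.distrib[symmetric]
      by (rule sum.cong[OF refl]) (simp only: u_step atMost_iff distrib_left)
    then show ?thesis
      using top by (simp add: kj mult.left_commute add_ac del: of_nat_Suc)
  qed
  finally show ?thesis
    unfolding z_A z_H unfolding A_def H_def by (simp add: distrib_left mult.assoc)
qed

lemma connection_coeff_0:
  assumes "\<And>n. u n 0 = 1 \<oslash> l2 n 0"
  shows "connection_coeff m l1 u n 0 = l1 n 0 \<oslash> l2 n 0"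
  using assms by (simp add: connection_coeff_def unit_quot_def)

theorem theorem4p2:
  fixes m :: nat
    and lambda1 mu1 :: "nat \<Rightarrow> int \<Rightarrow> 'a::{comm_ring, comm_monoid_mult}"
    and p1 p2 h1 h2 c1 c2 :: "nat \<Rightarrow> 'a"
  assumes "m \<ge> 1"
    and "lambda1 \<in> Delta m" and "mu1 \<in> Delta m"
    and "\<forall>r<m. lambda1 r 0 dvd 1" and "\<forall>r<m. mu1 r 0 dvd 1"
    and "lambda_recursive m p1 h1 c1 lambda1"
    and "lambda_recursive m p2 h2 c2 mu1"
  defines "f \<equiv> lambda_poly m lambda1"
    and "g \<equiv> lambda_poly m mu1"
  shows
    "(\<forall>mu3 \<in> Delta m.
        (\<forall>n. monom 1 n = (\<Sum>k = 0..w m n. smult (mu3 n (int k)) (g (n - m * k)))) \<and>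
        (\<forall>n. mu3 n 0 = 1 \<oslash> mu1 n 0) \<and>
        (\<forall>n k. 1 \<le> k \<and> k \<le> int (w m n) \<longrightarrow>
           mu3 n k = A_coeff m p2 mu1 n k * mu3 (n - 1) k
             + (h2 (s_index m n k) \<oslash> p2 (s_index m n k)) * mu3 (n - 1) (k - 1))
      \<longrightarrow>
        (let z = connection_coeff m lambda1 mu3 in
          (\<forall>n. f n = (\<Sum>k = 0..w m n. smult (z n (int k)) (g (n - m * k)))) \<and>
          (\<forall>n. z n 0 = lambda1 n 0 \<oslash> mu1 n 0) \<and>
          (\<forall>n k. 1 \<le> k \<and> k \<le> int (w m n) \<longrightarrow>
             z n k = p1 n * A_coeff m p2 mu1 n k * z (n - 1) k
               + p1 n * (h2 (s_index m n k) \<oslash> p2 (s_index m n k)) * z (n - 1) (k - 1)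
               - h1 n * z (n - m) (k - 1))))
     \<and>
     (\<forall>lambda3 \<in> Delta m.
        (\<forall>n. monom 1 n = (\<Sum>k = 0..w m n. smult (lambda3 n (int k)) (f (n - m * k)))) \<and>
        (\<forall>n. lambda3 n 0 = 1 \<oslash> lambda1 n 0) \<and>
        (\<forall>n k. 1 \<le> k \<and> k \<le> int (w m n) \<longrightarrow>
           lambda3 n k = A_coeff m p1 lambda1 n k * lambda3 (n - 1) k
             + (h1 (s_index m n k) \<oslash> p1 (s_index m n k)) * lambda3 (n - 1) (k - 1))
      \<longrightarrow>
        (let y = connection_coeff m mu1 lambda3 in
          (\<forall>n. g n = (\<Sum>k = 0..w m n. smult (y n (int k)) (f (n - m * k)))) \<and>
          (\<forall>n. y n 0 = mu1 n 0 \<oslash> lambda1 n 0) \<and>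
          (\<forall>n k. 1 \<le> k \<and> k \<le> int (w m n) \<longrightarrow>
             y n k = p2 n * A_coeff m p1 lambda1 n k * y (n - 1) k
               + p2 n * (h1 (s_index m n k) \<oslash> p1 (s_index m n k)) * y (n - 1) (k - 1)
               - h2 n * y (n - m) (k - 1))))"
  unfolding Let_def f_def g_def
  \<comment> \<open>The two instances of \<open>connection_coeff_rec\<close> differ by exchanging
    \<open>lambda1\<close> and \<open>mu1\<close> together with their unit and recursion
    hypotheses.\<close>
  by (intro conjI ballI impI allI; elim conjE;
      rule lambda_poly_connection[OF assms(1)] connection_coeff_0
        connection_coeff_rec[OF assms(1,2,3,5,6,7)] connection_coeff_rec[OF assms(1,3,2,4,7,6)];
      simp)

end
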